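(* For every real number $\varepsilon>0$, there exist a positive integer $n$ and a transitive permutation group $G$ of degree $n$ such that $$\mu(G)\,b(G)\ge n^{2-\varepsilon}.$$
   Context: Permutation groups are finite groups of permutations of a finite set $\Omega$; the degree is $|\Omega|$. The minimal degree $\mu(G)$ of a (nontrivial) permutation group $G$ on $\Omega$ is the smallest number of points of $\Omega$ moved by a non-identity element of $G$. A base for $G$ is a sequence $(\omega_1,\dots,\omega_\ell)$ of points of $\Omega$ whose pointwise stabilizer in $G$ is trivial; the base size $b(G)$ is the smallest cardinality of a base for $G$. *)

theory Defs
  imports Complex_Main "HOL-Algebra.Group_Action"
begin

text \<open>
  A permutation group on \<Omega> is given by its set of elements, a subgroup of the library's symmetric
  group \<^term>\<open>BijGroup \<Omega>\<close>. Elements of the latter are extensional functions: they are unspecified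
  outside \<Omega>, so moved points and base points are always taken inside \<Omega>.
\<close>

definition permutation_group :: "'a set \<Rightarrow> ('a \<Rightarrow> 'a) set \<Rightarrow> bool" where
  "permutation_group \<Omega> G \<longleftrightarrow> finite \<Omega> \<and> subgroup G (BijGroup \<Omega>)"

definition transitive_permutation_group :: "'a set \<Rightarrow> ('a \<Rightarrow> 'a) set \<Rightarrow> bool" where
  "transitive_permutation_group \<Omega> G \<longleftrightarrow>
     permutation_group \<Omega> G \<and>
     transitive_action ((BijGroup \<Omega>)\<lparr>carrier := G\<rparr>) \<Omega> (\<lambda>g. g)"

definition moved_points :: "'a set \<Rightarrow> ('a \<Rightarrow> 'a) \<Rightarrow> 'a set" where
  "moved_points \<Omega> g = {x \<in> \<Omega>. g x \<noteq> x}"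

text \<open>Meaningful only for a nontrivial group, as the set minimised over is otherwise empty.\<close>

definition minimal_degree :: "'a set \<Rightarrow> ('a \<Rightarrow> 'a) set \<Rightarrow> nat" where
  "minimal_degree \<Omega> G =
     (LEAST m. \<exists>g\<in>G. g \<noteq> \<one>\<^bsub>BijGroup \<Omega>\<^esub> \<and> m = card (moved_points \<Omega> g))"

definition is_base :: "'a set \<Rightarrow> ('a \<Rightarrow> 'a) set \<Rightarrow> 'a list \<Rightarrow> bool" where
  "is_base \<Omega> G ws \<longleftrightarrow>
     set ws \<subseteq> \<Omega> \<and> {g \<in> G. \<forall>w\<in>set ws. g w = w} = {\<one>\<^bsub>BijGroup \<Omega>\<^esub>}"

definition base_size :: "'a set \<Rightarrow> ('a \<Rightarrow> 'a) set \<Rightarrow> nat" where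
  "base_size \<Omega> G = (LEAST l. \<exists>ws. is_base \<Omega> G ws \<and> l = length ws)"

end

theory Submission
  imports Defs "HOL-Computational_Algebra.Polynomial" "HOL-Computational_Algebra.Primes"
begin

text \<open>
  For a prime \<open>p = 2 r + 1\<close>, take the code of all functions \<open>(\<int>/p)\<^sup>s \<rightarrow> \<int>/p\<close> that restrict to a
  polynomial of degree at most \<open>r\<close> on every line parallel to an axis. It is translation
  invariant, so the maps \<open>(v, y) \<mapsto> (v + t, y + f v)\<close> form a transitive group of
  degree \<open>n = p\<^sup>s\<^sup>+\<^sup>1\<close>. A map with \<open>t \<noteq> 0\<close> moves every point; one with \<open>t = 0\<close> and \<open>f \<noteq> 0\<close>
  moves \<open>p\<close> points for each element of the support of \<open>f\<close>, which has at least
  \<open>(p - r)\<^sup>s\<close> elements (move along one axis after another). Values on \<open>{0, \<dots>, r}\<^sup>s\<close> can be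
  prescribed arbitrarily, so the group has at least \<open>p\<close> to the power \<open>(r + 1)\<^sup>s\<close> elements,
  and at most \<open>n\<close> to the power of its base size. Hence \<open>\<mu> b \<ge> p\<^sup>2\<^sup>s\<^sup>+\<^sup>1 / (4\<^sup>s (s + 1))\<close>, where
  \<open>p\<^sup>2\<^sup>s\<^sup>+\<^sup>1\<close> is \<open>n\<close> to the power \<open>2 - 1 / (s + 1)\<close>.
\<close>

subsection \<open>Permutation groups\<close>

lemma mult_BijGroup:
  assumes "g \<in> Bij \<Omega>" "h \<in> Bij \<Omega>"
  shows "g \<otimes>\<^bsub>BijGroup \<Omega>\<^esub> h = compose \<Omega> g h"
  using assms by (simp add: BijGroup_def)

lemma one_BijGroup: "\<one>\<^bsub>BijGroup \<Omega>\<^esub> = (\<lambda>x\<in>\<Omega>. x)"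
  by (simp add: BijGroup_def)

lemma Bij_identity_iff:
  assumes "g \<in> Bij \<Omega>"
  shows "g = \<one>\<^bsub>BijGroup \<Omega>\<^esub> \<longleftrightarrow> (\<forall>x\<in>\<Omega>. g x = x)"
proof
  assume "\<forall>x\<in>\<Omega>. g x = x"
  then show "g = \<one>\<^bsub>BijGroup \<Omega>\<^esub>"
    using Bij_imp_extensional[OF assms] by (auto simp: BijGroup_def extensional_def)
qed (simp add: BijGroup_def)

text \<open>Nontriviality makes the set under \<open>LEAST\<close> nonempty, so the minimum is
  attained by some nonidentity element and a uniform lower bound applies to it.\<close>

lemma le_minimal_degree:
  assumes "permutation_group \<Omega> G" "G \<noteq> {\<one>\<^bsub>BijGroup \<Omega>\<^esub>}"
    and "\<And>g. g \<in> G \<Longrightarrow> g \<noteq> \<one>\<^bsub>BijGroup \<Omega>\<^esub> \<Longrightarrow> d \<le> card (moved_points \<Omega> g)"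
  shows "d \<le> minimal_degree \<Omega> G"
proof -
  have "\<one>\<^bsub>BijGroup \<Omega>\<^esub> \<in> G"
    using assms(1) by (simp add: permutation_group_def subgroup.one_closed)
  then obtain g where "g \<in> G" "g \<noteq> \<one>\<^bsub>BijGroup \<Omega>\<^esub>" using assms(2) by auto
  then have "\<exists>m. \<exists>g\<in>G. g \<noteq> \<one>\<^bsub>BijGroup \<Omega>\<^esub> \<and> m = card (moved_points \<Omega> g)" by blast
  from LeastI_ex[OF this] show ?thesis
    unfolding minimal_degree_def using assms(3) by auto
qed

text \<open>A list of all points is a base, because an element fixing all of \<open>\<Omega>\<close>
  is the identity; hence the \<open>LEAST\<close> in \<open>base_size\<close> is attained.\<close>

lemma ex_base_of_base_size:
  assumes "permutation_group \<Omega> G"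
  obtains ws where "is_base \<Omega> G ws" "length ws = base_size \<Omega> G"
proof -
  have sub: "G \<subseteq> Bij \<Omega>"
    using assms subgroup.subset by (fastforce simp: permutation_group_def BijGroup_def)
  obtain ws where ws: "set ws = \<Omega>"
    using assms finite_list by (auto simp: permutation_group_def)
  have one: "\<one>\<^bsub>BijGroup \<Omega>\<^esub> \<in> G"
    using assms by (simp add: permutation_group_def subgroup.one_closed)
  have "is_base \<Omega> G ws"
    using sub one Bij_identity_iff ws unfolding is_base_def by (auto simp: BijGroup_def)
  then have "\<exists>l. \<exists>ws. is_base \<Omega> G ws \<and> l = length ws" by blast
  from LeastI_ex[OF this] show ?thesis
    unfolding base_size_def[symmetric] using that by metis
qed

text \<open>An element is determined by its images of the points of a base: if \<open>g\<close> and
  \<open>h\<close> agree there, \<open>h\<close> inverse times \<open>g\<close> fixes the base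
  pointwise and is trivial. This turns a lower bound on the group order into one on the base
  size.\<close>

lemma card_le_power_base_size:
  assumes "permutation_group \<Omega> G"
  shows "card G \<le> card \<Omega> ^ base_size \<Omega> G"
proof -
  obtain ws where ws: "is_base \<Omega> G ws" "length ws = base_size \<Omega> G"
    using ex_base_of_base_size[OF assms] .
  have fin: "finite \<Omega>" and sg: "subgroup G (BijGroup \<Omega>)"
    using assms by (auto simp: permutation_group_def)
  have wsub: "set ws \<subseteq> \<Omega>" using ws by (simp add: is_base_def)
  have sub: "G \<subseteq> Bij \<Omega>"
    using subgroup.subset[OF sg] by (simp add: BijGroup_def)
  have "inj_on (\<lambda>g. map g ws) G"
  proof (rule inj_onI)
    fix g h assume g: "g \<in> G" and h: "h \<in> G" and "map g ws = map h ws"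
    then have eq: "g w = h w" if "w \<in> set ws" for w using that by auto
    have gB: "g \<in> Bij \<Omega>" and hB: "h \<in> Bij \<Omega>" using sub g h by auto
    let ?k = "inv\<^bsub>BijGroup \<Omega>\<^esub> h \<otimes>\<^bsub>BijGroup \<Omega>\<^esub> g"
    have kG: "?k \<in> G"
      using g h sg by (simp add: subgroup.m_closed subgroup.m_inv_closed)
    have "?k = compose \<Omega> (restrict (inv_into \<Omega> h) \<Omega>) g"
      unfolding inv_BijGroup[OF hB] by (rule mult_BijGroup[OF restrict_inv_into_Bij[OF hB] gB])
    then have k: "?k x = inv_into \<Omega> h (g x)" if "x \<in> \<Omega>" for x
      using that funcset_mem[OF Bij_imp_funcset[OF gB]] by (simp add: compose_def)
    have "?k w = w" if "w \<in> set ws" for w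
    proof -
      have "w \<in> \<Omega>" using that wsub by auto
      then show ?thesis using k eq[OF that] hB
        by (simp add: Bij_def bij_betw_def)
    qed
    then have one: "?k = \<one>\<^bsub>BijGroup \<Omega>\<^esub>" using kG ws(1) unfolding is_base_def by blast
    have "g x = h x" if x: "x \<in> \<Omega>" for x
    proof -
      have "inv_into \<Omega> h (g x) = x" using k[OF x] unfolding one one_BijGroup using x by simp
      moreover have "g x \<in> h ` \<Omega>"
        using x gB hB by (auto simp: Bij_def bij_betw_def)
      ultimately show ?thesis by (metis f_inv_into_f)
    qed
    then show "g = h"
      using gB hB Bij_imp_extensional extensionalityI by metis
  qed
  moreover have "(\<lambda>g. map g ws) ` G \<subseteq> {xs. set xs \<subseteq> \<Omega> \<and> length xs = base_size \<Omega> G}"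
  proof (rule image_subsetI)
    fix g assume "g \<in> G"
    then have "g \<in> \<Omega> \<rightarrow> \<Omega>" using sub Bij_imp_funcset by auto
    then show "map g ws \<in> {xs. set xs \<subseteq> \<Omega> \<and> length xs = base_size \<Omega> G}"
      using ws(2) wsub by auto
  qed
  ultimately have "card G \<le> card {xs. set xs \<subseteq> \<Omega> \<and> length xs = base_size \<Omega> G}"
    using card_inj_on_le finite_lists_length_eq[OF fin] by blast
  then show ?thesis by (simp add: card_lists_length_eq[OF fin])
qed

section \<open>Relabelling permutations along an injection\<close>

text \<open>Conjugation by \<open>e\<close>. The group is built on pairs of a vector and a residue
  and then moved to a set of natural numbers; \<open>restrict\<close> supplies the extensionality
  that \<open>Bij\<close> demands.\<close>

definition transport_perm :: "('x \<Rightarrow> 'a) \<Rightarrow> 'x set \<Rightarrow> ('x \<Rightarrow> 'x) \<Rightarrow> 'a \<Rightarrow> 'a" where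
  "transport_perm e X h = (\<lambda>k\<in>e ` X. e (h (inv_into X e k)))"

lemma transport_perm_apply:
  assumes "inj_on e X" "x \<in> X"
  shows "transport_perm e X h (e x) = e (h x)"
  using assms by (simp add: transport_perm_def)

lemma transport_perm_Bij:
  assumes "inj_on e X" "bij_betw h X X"
  shows "transport_perm e X h \<in> Bij (e ` X)"
proof -
  have "bij_betw e X (e ` X)" using assms(1) by (simp add: bij_betw_def)
  then have "bij_betw (e \<circ> (h \<circ> inv_into X e)) (e ` X) (e ` X)"
    using assms(2) bij_betw_inv_into bij_betw_trans by metis
  then have "bij_betw (transport_perm e X h) (e ` X) (e ` X)"
    by (rule bij_betw_cong[THEN iffD1, rotated]) (simp add: transport_perm_def)
  then show ?thesis by (simp add: Bij_def transport_perm_def)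
qed

lemma transport_perm_eq_one_iff:
  assumes "inj_on e X" "bij_betw h X X"
  shows "transport_perm e X h = \<one>\<^bsub>BijGroup (e ` X)\<^esub> \<longleftrightarrow> (\<forall>x\<in>X. h x = x)"
proof -
  have "e (h x) = e x \<longleftrightarrow> h x = x" if "x \<in> X" for x
    using that assms by (metis bij_betwE inj_on_eq_iff)
  then show ?thesis
    using Bij_identity_iff[OF transport_perm_Bij[OF assms]] transport_perm_apply[OF assms(1)]
    by simp
qed

lemma card_moved_points_transport_perm:
  assumes "inj_on e X" "bij_betw h X X"
  shows "card (moved_points (e ` X) (transport_perm e X h)) = card {x\<in>X. h x \<noteq> x}"
proof -
  have "e (h x) = e x \<longleftrightarrow> h x = x" if "x \<in> X" for x
    using that assms by (metis bij_betwE inj_on_eq_iff)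
  then have "moved_points (e ` X) (transport_perm e X h) = e ` {x\<in>X. h x \<noteq> x}"
    using transport_perm_apply[OF assms(1)] by (auto simp: moved_points_def)
  then show ?thesis
    using assms(1) by (metis (no_types, lifting) card_image inj_on_subset mem_Collect_eq subsetI)
qed

text \<open>Only behaviour on \<open>X\<close> survives relabelling, so distinctness has to be
  assumed for the restrictions of the \<open>F i\<close> rather than for the total
  functions.\<close>

lemma inj_on_transport_perm:
  assumes "inj_on e X" "inj_on (\<lambda>i. restrict (F i) X) I" "\<And>i. i \<in> I \<Longrightarrow> F i \<in> X \<rightarrow> X"
  shows "inj_on (\<lambda>i. transport_perm e X (F i)) I"
proof (rule inj_onI)
  fix i j assume ij: "i \<in> I" "j \<in> I" and eq: "transport_perm e X (F i) = transport_perm e X (F j)"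
  have "F i x = F j x" if "x \<in> X" for x
  proof -
    have "e (F i x) = e (F j x)" using eq transport_perm_apply[OF assms(1) that] by metis
    then show ?thesis using assms(1,3) ij that by (meson PiE inj_onD)
  qed
  then have "restrict (F i) X = restrict (F j) X" by (simp add: restrict_def fun_eq_iff)
  then show "i = j" using assms(2) ij by (meson inj_onD)
qed

lemma transport_perm_comp:
  assumes "inj_on e X" "bij_betw h X X" "bij_betw k X X"
  shows "transport_perm e X h \<otimes>\<^bsub>BijGroup (e ` X)\<^esub> transport_perm e X k = transport_perm e X (h \<circ> k)"
proof -
  have "compose (e ` X) (transport_perm e X h) (transport_perm e X k) y = transport_perm e X (h \<circ> k) y" for y
  proof (cases "y \<in> e ` X")
    case True
    then obtain x where x: "x \<in> X" "y = e x" by auto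
    moreover have "k x \<in> X" using x assms(3) by (auto dest: bij_betwE)
    ultimately show ?thesis
      by (simp add: compose_def transport_perm_apply[OF assms(1)])
  qed (simp add: compose_def transport_perm_def)
  then show ?thesis
    using transport_perm_Bij[OF assms(1,2)] transport_perm_Bij[OF assms(1,3)]
    by (simp add: BijGroup_def fun_eq_iff)
qed

text \<open>\<open>S\<close> consists of total functions. Inverses are asked for on \<open>X\<close>
  only, since a map sending everything into \<open>X\<close> cannot be undone elsewhere; a left
  inverse suffices inside the group of bijections.\<close>

lemma transitive_permutation_group_transport_perm:
  assumes fin: "finite X" and e: "inj_on e X" and ne: "S \<noteq> {}"
    and maps: "\<And>h. h \<in> S \<Longrightarrow> bij_betw h X X"
    and comp: "\<And>h k. h \<in> S \<Longrightarrow> k \<in> S \<Longrightarrow> h \<circ> k \<in> S"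
    and inv: "\<And>h. h \<in> S \<Longrightarrow> \<exists>k\<in>S. \<forall>x\<in>X. k (h x) = x"
    and trans: "\<And>x y. x \<in> X \<Longrightarrow> y \<in> X \<Longrightarrow> \<exists>h\<in>S. h x = y"
  shows "transitive_permutation_group (e ` X) (transport_perm e X ` S)"
proof -
  let ?G = "transport_perm e X ` S" and ?B = "BijGroup (e ` X)"
  interpret B: group ?B by (rule group_BijGroup)
  have carr: "transport_perm e X h \<in> carrier ?B" if "h \<in> S" for h
    using transport_perm_Bij[OF e maps[OF that]] by (simp add: BijGroup_def)
  have sg: "subgroup ?G ?B"
  proof (rule B.subgroupI)
    show "?G \<subseteq> carrier ?B" using carr by auto
    show "?G \<noteq> {}" using ne by simp
    fix a assume "a \<in> ?G"
    then obtain h where h: "h \<in> S" "a = transport_perm e X h" by auto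
    obtain k where k: "k \<in> S" "\<forall>x\<in>X. k (h x) = x" using inv h by auto
    have bij: "bij_betw (k \<circ> h) X X" using maps[OF comp[OF k(1) h(1)]] .
    have "transport_perm e X k \<otimes>\<^bsub>?B\<^esub> transport_perm e X h = \<one>\<^bsub>?B\<^esub>"
      using transport_perm_comp[OF e maps[OF k(1)] maps[OF h(1)]] transport_perm_eq_one_iff[OF e bij] k(2)
      by simp
    then have "inv\<^bsub>?B\<^esub> a = transport_perm e X k"
      using B.inv_equality carr h k by metis
    then show "inv\<^bsub>?B\<^esub> a \<in> ?G" using k by simp
  next
    fix a b assume "a \<in> ?G" "b \<in> ?G"
    then show "a \<otimes>\<^bsub>?B\<^esub> b \<in> ?G"
      using transport_perm_comp[OF e maps maps] comp by auto
  qed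
  then have "group_hom (?B\<lparr>carrier := ?G\<rparr>) ?B (\<lambda>g. g)"
    using B.subgroup_imp_group[OF sg] subgroup.subset[OF sg] B.group_axioms
    by (auto simp: group_hom_def group_hom_axioms_def hom_def)
  moreover have "\<exists>g\<in>?G. g u = v" if uv: "u \<in> e ` X" "v \<in> e ` X" for u v
  proof -
    obtain x y where xy: "x \<in> X" "y \<in> X" "u = e x" "v = e y" using uv by auto
    obtain h where "h \<in> S" "h x = y" using trans xy by blast
    then show ?thesis using transport_perm_apply[OF e xy(1)] xy by auto
  qed
  ultimately have "transitive_action (?B\<lparr>carrier := ?G\<rparr>) (e ` X) (\<lambda>g. g)"
    by (simp add: transitive_action_def transitive_action_axioms_def group_action_def)
  then show ?thesis
    using sg fin by (simp add: transitive_permutation_group_def permutation_group_def)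
qed

subsection \<open>A locally low-degree code\<close>

text \<open>Lagrange's bound on roots over a field, phrased with integers and divisibility: split
  off a root \<open>a\<close> by synthetic division, observe that the quotient vanishes at the
  remaining roots, and induct on the degree bound.\<close>

lemma poly_dvd_of_many_roots_mod:
  fixes P :: "int poly" and p :: int
  assumes "prime p" "degree P \<le> r" "finite A" "card A > r"
    and "\<And>a b. a \<in> A \<Longrightarrow> b \<in> A \<Longrightarrow> p dvd a - b \<Longrightarrow> a = b"
    and "\<And>a. a \<in> A \<Longrightarrow> p dvd poly P a"
  shows "p dvd poly P x"
  using assms
proof (induction r arbitrary: P A x)
  case 0
  then obtain c where "P = [:c:]" by (metis degree_eq_zeroE le_zero_eq)
  moreover obtain a where "a \<in> A" using 0 by fastforce
  ultimately show ?case using 0 by fastforce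
next
  case (Suc r)
  obtain a where a: "a \<in> A" using Suc.prems by fastforce
  define Q where "Q = synthetic_div P a"
  have eq: "poly P y = (y - a) * poly Q y + poly P a" for y
  proof -
    have "poly P y = poly ([:- a, 1:] * Q + [:poly P a:]) y"
      by (simp only: Q_def synthetic_div_correct')
    then show ?thesis by (simp add: algebra_simps)
  qed
  have "p dvd poly Q x"
  proof (rule Suc.IH[of Q "A - {a}"])
    show "degree Q \<le> r" using Suc.prems by (simp add: Q_def degree_synthetic_div)
    show "card (A - {a}) > r" using Suc.prems a by simp
    fix b assume b: "b \<in> A - {a}"
    have "p dvd (b - a) * poly Q b"
      using eq[of b] Suc.prems(6)[of a] Suc.prems(6)[of b] a b by (simp add: dvd_add_left_iff)
    \<comment> \<open>Incongruence of the elements of \<open>A\<close> makes \<open>b - a\<close> a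
      unit modulo \<open>p\<close>, so it cancels.\<close>
    moreover have "\<not> p dvd b - a" using Suc.prems(5) a b by blast
    ultimately show "p dvd poly Q b" using Suc.prems(1) prime_dvd_mult_iff by blast
  qed (use Suc.prems in auto)
  then show ?case using eq[of x] Suc.prems(6)[OF a] by (metis dvd_add dvd_mult)
qed

lemma card_nonroots_mod:
  fixes P :: "int poly" and p :: int
  assumes "prime p" "degree P \<le> r" "\<not> p dvd poly P x"
  shows "nat p - r \<le> card {y\<in>{0..<p}. \<not> p dvd poly P y}"
proof -
  let ?Z = "{y\<in>{0..<p}. p dvd poly P y}"
  have "card ?Z \<le> r"
  proof (rule ccontr)
    assume "\<not> card ?Z \<le> r"
    then have card: "card ?Z > r" by simp
    have "p dvd poly P x"
    proof (rule poly_dvd_of_many_roots_mod[OF assms(1,2) _ card])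
      fix a b assume "a \<in> ?Z" "b \<in> ?Z" "p dvd a - b"
      then show "a = b"
        by (metis (no_types, lifting) atLeastLessThan_iff mem_Collect_eq mod_eq_dvd_iff mod_pos_pos_trivial)
    qed (simp_all add: finite_subset[of _ "{0..<p}"] subset_iff)
    with assms(3) show False by simp
  qed
  moreover have "card {y\<in>{0..<p}. \<not> p dvd poly P y} + card ?Z
      = card ({y\<in>{0..<p}. \<not> p dvd poly P y} \<union> ?Z)"
    by (rule card_Un_disjoint[symmetric]) (auto simp: finite_subset[of _ "{0..<p}"] subset_iff)
  moreover have "{y\<in>{0..<p}. \<not> p dvd poly P y} \<union> ?Z = {0..<p}" by blast
  ultimately show ?thesis by simp
qed

section \<open>The code and the size of supports\<close>

text \<open>With \<open>q = p\<close> this is the set of reduced representatives of the vectors over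
  the integers modulo \<open>p\<close>; with \<open>q = r + 1\<close> it is the set of interpolation
  nodes.\<close>

definition grid :: "int \<Rightarrow> nat \<Rightarrow> (nat \<Rightarrow> int) set" where
  "grid q s = {..<s} \<rightarrow>\<^sub>E {0..<q}"

lemma finite_grid: "finite (grid q s)"
  by (simp add: grid_def finite_PiE)

lemma card_grid: "card (grid q s) = nat q ^ s"
  by (simp add: grid_def card_PiE)

lemma grid_nth: "v \<in> grid q s \<Longrightarrow> i < s \<Longrightarrow> v i \<in> {0..<q}"
  unfolding grid_def by (drule PiE_mem[of _ _ _ i]) simp_all

lemma grid_fun_upd: "v \<in> grid q s \<Longrightarrow> i < s \<Longrightarrow> x \<in> {0..<q} \<Longrightarrow> v(i := x) \<in> grid q s"
  by (auto simp: grid_def PiE_iff extensional_def)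

text \<open>As \<open>x\<close> varies, \<open>v(i := x)\<close> runs through the line in direction
  \<open>i\<close> through \<open>v\<close>. Words are integer valued and constrained only on the
  grid, up to multiples of \<open>p\<close>.\<close>

definition line_code :: "int \<Rightarrow> nat \<Rightarrow> nat \<Rightarrow> ((nat \<Rightarrow> int) \<Rightarrow> int) set" where
  "line_code p s r = {f. \<forall>v\<in>grid p s. \<forall>i<s. \<exists>P. degree P \<le> r \<and>
     (\<forall>x\<in>{0..<p}. p dvd f (v(i := x)) - poly P x)}"

lemma line_codeE:
  assumes "f \<in> line_code p s r" "v \<in> grid p s" "i < s"
  obtains P where "degree P \<le> r" "\<And>x. x \<in> {0..<p} \<Longrightarrow> p dvd f (v(i := x)) - poly P x"
  using assms unfolding line_code_def by blast

text \<open>Coordinates are released one at a time: on an axis-parallel line meeting the support, at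
  least \<open>p - r\<close> points lie in the support, and each serves as a new starting point for
  the coordinates released before.\<close>

lemma line_code_weight:
  assumes p: "prime p" and f: "f \<in> line_code p s r" and v: "v \<in> grid p s" "\<not> p dvd f v"
  shows "(nat p - r) ^ s \<le> card {w \<in> grid p s. \<not> p dvd f w}"
proof -
  \<comment> \<open>Support points that agree with \<open>v\<close> from coordinate \<open>k\<close>
    on, so only the first \<open>k\<close> coordinates are free.\<close>
  define N where "N k v = {w \<in> grid p s. \<not> p dvd f w \<and> (\<forall>i\<ge>k. w i = v i)}" for k v
  have finN: "finite (N k v)" for k v
    unfolding N_def by (rule finite_subset[OF _ finite_grid]) auto
  have "(nat p - r) ^ k \<le> card (N k v)" if "k \<le> s" "v \<in> grid p s" "\<not> p dvd f v" for k v
    using that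
  proof (induction k arbitrary: v)
    case 0
    then have "v \<in> N 0 v" by (simp add: N_def)
    then have "card (N 0 v) > 0" using finN card_gt_0_iff by blast
    then show ?case by simp
  next
    case (Suc k)
    then have k: "k < s" by simp
    obtain P where P: "degree P \<le> r" "\<And>x. x \<in> {0..<p} \<Longrightarrow> p dvd f (v(k := x)) - poly P x"
      using line_codeE[OF f Suc.prems(2) k] by blast
    have iff: "p dvd f (v(k := x)) \<longleftrightarrow> p dvd poly P x" if "x \<in> {0..<p}" for x
      using P(2)[OF that] by (metis diff_add_cancel dvd_add_right_iff)
    have vk: "v k \<in> {0..<p}" using Suc.prems(2) k by (rule grid_nth)
    have "\<not> p dvd poly P (v k)" using iff[OF vk] Suc.prems(3) by simp
    then have "nat p - r \<le> card {y\<in>{0..<p}. \<not> p dvd poly P y}" (is "_ \<le> card ?Y")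
      by (rule card_nonroots_mod[OF p P(1)])
    then have "(nat p - r) ^ Suc k \<le> card ?Y * (nat p - r) ^ k" by simp
    also have "\<dots> = (\<Sum>x\<in>?Y. (nat p - r) ^ k)" by simp
    also have "\<dots> \<le> (\<Sum>x\<in>?Y. card (N k (v(k := x))))"
    proof (rule sum_mono)
      fix x assume "x \<in> ?Y"
      then have x: "x \<in> {0..<p}" "\<not> p dvd poly P x" by simp_all
      then show "(nat p - r) ^ k \<le> card (N k (v(k := x)))"
        using k iff[OF x(1)] by (intro Suc.IH grid_fun_upd[OF Suc.prems(2)]) (simp_all del: fun_upd_apply)
    qed
    \<comment> \<open>The sets are disjoint because their members carry different values in
      coordinate \<open>k\<close>.\<close>
    also have "\<dots> = card (\<Union>x\<in>?Y. N k (v(k := x)))"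
    proof (subst card_UN_disjoint)
      show "\<forall>x\<in>?Y. \<forall>y\<in>?Y. x \<noteq> y \<longrightarrow> N k (v(k := x)) \<inter> N k (v(k := y)) = {}"
      proof (intro ballI impI, rule ccontr)
        fix x y assume "x \<noteq> y" "N k (v(k := x)) \<inter> N k (v(k := y)) \<noteq> {}"
        then obtain w where "w k = (v(k := x)) k" "w k = (v(k := y)) k" unfolding N_def by blast
        with \<open>x \<noteq> y\<close> show False by simp
      qed
    qed (simp_all add: finN finite_subset[of _ "{0..<p}"] subset_iff)
    also have "\<dots> \<le> card (N (Suc k) v)"
      by (intro card_mono[OF finN]) (auto simp: N_def)
    finally show ?case .
  qed
  from this[OF order.refl v] have "(nat p - r) ^ s \<le> card (N s v)" .
  also have "\<dots> \<le> card {w \<in> grid p s. \<not> p dvd f w}"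
    by (intro card_mono) (auto simp: N_def finite_grid)
  finally show ?thesis .
qed

text \<open>Up to a unit modulo \<^term>\<open>p\<close>, the Lagrange basis on the nodes \<open>0, \<dots>, r\<close> of each axis.\<close>

definition lagrange_word :: "nat \<Rightarrow> nat \<Rightarrow> ((nat \<Rightarrow> int) \<Rightarrow> int) \<Rightarrow> (nat \<Rightarrow> int) \<Rightarrow> int" where
  "lagrange_word s r c v =
     (\<Sum>a\<in>grid (int r + 1) s. c a * (\<Prod>i<s. \<Prod>k\<in>{0..int r} - {a i}. v i - k))"

text \<open>Along axis \<open>i\<close>, every summand is a constant times a product of linear
  factors in the moving coordinate; \<open>D a\<close> collects the factors from the other
  axes.\<close>

lemma lagrange_word_in_line_code: "lagrange_word s r c \<in> line_code p s r"
  unfolding line_code_def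
proof (intro CollectI ballI allI impI)
  fix v i assume v: "v \<in> grid p s" and i: "i < s"
  define D where "D a = (\<Prod>j\<in>{..<s} - {i}. \<Prod>k\<in>{0..int r} - {a j}. v j - k)" for a
  define P where "P = (\<Sum>a\<in>grid (int r + 1) s. smult (c a * D a) (\<Prod>k\<in>{0..int r} - {a i}. [:- k, 1:]))"
  have "degree P \<le> r" unfolding P_def
  proof (intro degree_sum_le finite_grid)
    fix a assume "a \<in> grid (int r + 1) s"
    then have ai: "a i \<in> {0..int r}" using grid_nth i by fastforce
    \<comment> \<open>Because \<open>a i\<close> is one of the \<open>r + 1\<close> nodes, removing
      it leaves exactly \<open>r\<close> linear factors.\<close>
    have "degree (\<Prod>k\<in>{0..int r} - {a i}. [:- k, 1:]) \<le> r"
      by (rule order.trans[OF degree_prod_sum_le]) (use ai in auto)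
    then show "degree (smult (c a * D a) (\<Prod>k\<in>{0..int r} - {a i}. [:- k, 1:])) \<le> r"
      using degree_smult_le le_trans by blast
  qed
  moreover have "lagrange_word s r c (v(i := x)) = poly P x" for x
  proof -
    have "(\<Prod>j<s. \<Prod>k\<in>{0..int r} - {a j}. (v(i := x)) j - k)
        = (\<Prod>k\<in>{0..int r} - {a i}. x - k) * D a" for a
      unfolding D_def using i by (subst prod.remove[of _ i]) (auto intro!: prod.cong)
    then show ?thesis
      unfolding lagrange_word_def P_def
      by (simp add: poly_sum poly_prod mult_ac)
  qed
  ultimately show "\<exists>P. degree P \<le> r \<and> (\<forall>x\<in>{0..<p}. p dvd lagrange_word s r c (v(i := x)) - poly P x)"
    by (intro exI[of _ P]) simp
qed

text \<open>For a node \<open>a\<close> other than \<open>b\<close>, some coordinate of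
  \<open>b\<close> differs from that of \<open>a\<close> and is therefore among the roots of the
  corresponding factor.\<close>

lemma lagrange_word_at_node:
  assumes "b \<in> grid (int r + 1) s"
  shows "lagrange_word s r c b = c b * (\<Prod>i<s. \<Prod>k\<in>{0..int r} - {b i}. b i - k)"
proof -
  have "(\<Prod>i<s. \<Prod>k\<in>{0..int r} - {a i}. b i - k) = 0" if a: "a \<in> grid (int r + 1) s" "a \<noteq> b" for a
  proof -
    obtain i where i: "i < s" "a i \<noteq> b i"
      using a assms unfolding grid_def by (metis PiE_ext lessThan_iff)
    have "b i \<in> {0..int r} - {a i}" using grid_nth[OF assms i(1)] i(2) by auto
    then have "(\<Prod>k\<in>{0..int r} - {a i}. b i - k) = 0" by (intro prod_zero) auto
    then show ?thesis using i by (intro prod_zero) auto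
  qed
  then show ?thesis
    unfolding lagrange_word_def
    by (subst sum.remove[OF finite_grid assms]) (simp add: sum.neutral)
qed

text \<open>Evaluation at the nodes is diagonal in the coefficients, and its diagonal entries are
  units: each factor \<open>b i - k\<close> is nonzero of absolute value at most \<open>r\<close>,
  which is below \<open>p\<close>. So the words realise all prescribed values on the node
  grid.\<close>

lemma lagrange_word_inj:
  assumes p: "prime p" and r: "int r < p"
    and c: "c \<in> grid (int r + 1) s \<rightarrow>\<^sub>E {0..<p}" and d: "d \<in> grid (int r + 1) s \<rightarrow>\<^sub>E {0..<p}"
    and eq: "\<And>v. v \<in> grid p s \<Longrightarrow> p dvd lagrange_word s r c v - lagrange_word s r d v"
  shows "c = d"
proof (rule PiE_ext[OF c d])
  fix b assume b: "b \<in> grid (int r + 1) s"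
  let ?u = "\<Prod>i<s. \<Prod>k\<in>{0..int r} - {b i}. b i - k"
  have "b \<in> grid p s" using b r PiE_mono[of "{..<s}" "\<lambda>_. {0..<int r + 1}" "\<lambda>_. {0..<p}"]
    unfolding grid_def by auto
  from eq[OF this] have "p dvd (c b - d b) * ?u"
    by (simp add: lagrange_word_at_node[OF b] left_diff_distrib)
  moreover have "\<not> p dvd ?u"
  proof
    assume "p dvd ?u"
    then obtain i where i: "i < s" "p dvd (\<Prod>k\<in>{0..int r} - {b i}. b i - k)"
      by (auto simp only: prime_dvd_prod_iff[OF finite_lessThan p])
    have "finite ({0..int r} - {b i})" by simp
    then obtain k where k: "k \<in> {0..int r} - {b i}" "p dvd b i - k"
      using i(2) by (auto simp only: prime_dvd_prod_iff[OF _ p])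
    have "b i \<in> {0..int r}" using grid_nth[OF b i(1)] by auto
    then have "\<bar>b i - k\<bar> < p" "b i - k \<noteq> 0" using k(1) r by auto
    then show False using dvd_imp_le_int[OF _ k(2)] by linarith
  qed
  ultimately have "p dvd c b - d b" using p prime_dvd_mult_iff by blast
  moreover have "c b \<in> {0..<p}" "d b \<in> {0..<p}" using c d b by auto
  ultimately show "c b = d b"
    by (metis atLeastLessThan_iff mod_eq_dvd_iff mod_pos_pos_trivial)
qed

subsection \<open>The group of a code\<close>

lemma line_code_const: "(\<lambda>v. c) \<in> line_code p s r"
  unfolding line_code_def by (auto intro!: exI[of _ "[:c:]"])

lemma line_code_add:
  assumes f: "f \<in> line_code p s r" and g: "g \<in> line_code p s r"
  shows "(\<lambda>v. f v + g v) \<in> line_code p s r"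
  unfolding line_code_def
proof (intro CollectI ballI allI impI)
  fix v i assume vi: "v \<in> grid p s" "i < s"
  obtain P where P: "degree P \<le> r" "\<And>x. x \<in> {0..<p} \<Longrightarrow> p dvd f (v(i := x)) - poly P x"
    using line_codeE[OF f vi] by blast
  obtain Q where Q: "degree Q \<le> r" "\<And>x. x \<in> {0..<p} \<Longrightarrow> p dvd g (v(i := x)) - poly Q x"
    using line_codeE[OF g vi] by blast
  have "p dvd f (v(i := x)) + g (v(i := x)) - poly (P + Q) x" if "x \<in> {0..<p}" for x
    using dvd_add[OF P(2)[OF that] Q(2)[OF that]] by (simp add: algebra_simps)
  then show "\<exists>P. degree P \<le> r \<and> (\<forall>x\<in>{0..<p}. p dvd f (v(i := x)) + g (v(i := x)) - poly P x)"
    using degree_add_le[OF P(1) Q(1)] by blast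
qed

lemma line_code_uminus:
  assumes f: "f \<in> line_code p s r"
  shows "(\<lambda>v. - f v) \<in> line_code p s r"
  unfolding line_code_def
proof (intro CollectI ballI allI impI)
  fix v i assume vi: "v \<in> grid p s" "i < s"
  obtain P where P: "degree P \<le> r" "\<And>x. x \<in> {0..<p} \<Longrightarrow> p dvd f (v(i := x)) - poly P x"
    using line_codeE[OF f vi] by blast
  have "p dvd - f (v(i := x)) - poly (- P) x" if "x \<in> {0..<p}" for x
    using P(2)[OF that] by (simp add: dvd_diff_commute)
  then show "\<exists>P. degree P \<le> r \<and> (\<forall>x\<in>{0..<p}. p dvd - f (v(i := x)) - poly P x)"
    using P(1) by (metis degree_minus)
qed

definition add_mod :: "int \<Rightarrow> nat \<Rightarrow> (nat \<Rightarrow> int) \<Rightarrow> (nat \<Rightarrow> int) \<Rightarrow> nat \<Rightarrow> int" where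
  "add_mod p s v t = (\<lambda>i\<in>{..<s}. (v i + t i) mod p)"

lemma add_mod_in_grid: "p > 0 \<Longrightarrow> add_mod p s v t \<in> grid p s"
  by (simp add: add_mod_def grid_def)

lemma add_mod_assoc: "add_mod p s (add_mod p s v t) u = add_mod p s v (add_mod p s t u)"
proof (rule ext)
  fix i show "add_mod p s (add_mod p s v t) u i = add_mod p s v (add_mod p s t u) i"
    by (cases "i < s") (simp_all add: add_mod_def mod_add_left_eq mod_add_right_eq add.assoc)
qed

lemma grid_ext: "v \<in> grid p s \<Longrightarrow> w \<in> grid p s \<Longrightarrow> (\<And>i. i < s \<Longrightarrow> v i = w i) \<Longrightarrow> v = w"
  unfolding grid_def by (metis PiE_ext lessThan_iff)

lemma dvd_poly_diff:
  fixes a b d :: "'a::comm_ring_1"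
  assumes "d dvd a - b"
  shows "d dvd poly P a - poly P b"
proof (induction P)
  case (pCons c P)
  have "poly (pCons c P) a - poly (pCons c P) b = (a - b) * poly P a + b * (poly P a - poly P b)"
    by (simp add: algebra_simps)
  then show ?case using assms pCons.IH by simp
qed simp

text \<open>Translation carries axis-parallel lines to axis-parallel lines, shifting the parameter
  by \<open>t i\<close>; composing with the linear polynomial \<open>[:t i, 1:]\<close> keeps the
  degree bound.\<close>

lemma line_code_shift:
  assumes p: "p > 0" and f: "f \<in> line_code p s r"
  shows "(\<lambda>v. f (add_mod p s v t)) \<in> line_code p s r"
  unfolding line_code_def
proof (intro CollectI ballI allI impI)
  fix v i assume vi: "v \<in> grid p s" "i < s"
  obtain P where P: "degree P \<le> r"
    "\<And>x. x \<in> {0..<p} \<Longrightarrow> p dvd f ((add_mod p s v t)(i := x)) - poly P x"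
    using line_codeE[OF f add_mod_in_grid[OF p] vi(2)] by blast
  let ?Q = "pcompose P [:t i, 1:]"
  have "p dvd f (add_mod p s (v(i := x)) t) - poly ?Q x" for x
  proof -
    let ?x = "(x + t i) mod p"
    have "add_mod p s (v(i := x)) t = (add_mod p s v t)(i := ?x)"
      using vi(2) by (auto simp: add_mod_def fun_eq_iff)
    moreover have "p dvd f ((add_mod p s v t)(i := ?x)) - poly P ?x" using p by (intro P(2)) simp
    \<comment> \<open>The word sees the coordinate reduced modulo \<open>p\<close>, the composed
      polynomial sees it unreduced; congruent arguments give congruent values.\<close>
    moreover have "p dvd poly P ?x - poly P (x + t i)"
    proof -
      have "p dvd ?x - (x + t i)" by (metis dvd_minus_mod dvd_diff_commute)
      then show ?thesis by (rule dvd_poly_diff)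
    qed
    ultimately have "p dvd (f (add_mod p s (v(i := x)) t) - poly P ?x) + (poly P ?x - poly P (x + t i))"
      by (simp only: dvd_add)
    then show ?thesis by (simp add: poly_pcompose add.commute)
  qed
  moreover have "degree ?Q \<le> r" using degree_pcompose_le[of P "[:t i, 1:]"] P(1) by simp
  ultimately show "\<exists>P. degree P \<le> r \<and> (\<forall>x\<in>{0..<p}. p dvd f (add_mod p s (v(i := x)) t) - poly P x)"
    by blast
qed

section \<open>Permutations attached to translations and words\<close>

text \<open>On the grid times the residues, these are elements of an imprimitive wreath product:
  \<open>t\<close> permutes the fibres by translation and \<open>f\<close> rotates each fibre by its
  own amount.\<close>

definition code_perm ::
    "int \<Rightarrow> nat \<Rightarrow> (nat \<Rightarrow> int) \<Rightarrow> ((nat \<Rightarrow> int) \<Rightarrow> int) \<Rightarrow> (nat \<Rightarrow> int) \<times> int \<Rightarrow> (nat \<Rightarrow> int) \<times> int" where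
  "code_perm p s t f = (\<lambda>(v, y). (add_mod p s v t, (y + f v) mod p))"

text \<open>The second word enters translated by \<open>u\<close>, which is why the code has to be
  translation invariant.\<close>

lemma code_perm_comp:
  "code_perm p s t f \<circ> code_perm p s u g
    = code_perm p s (add_mod p s u t) (\<lambda>v. g v + f (add_mod p s v u))"
  by (auto simp: code_perm_def fun_eq_iff add_mod_assoc mod_simps add.assoc)

lemma code_perm_maps: "p > 0 \<Longrightarrow> code_perm p s t f x \<in> grid p s \<times> {0..<p}"
  by (simp add: code_perm_def add_mod_in_grid split: prod.split)

definition code_perms where
  "code_perms p s r = {code_perm p s t f | t f. t \<in> grid p s \<and> f \<in> line_code p s r}"

lemma code_permsI: "t \<in> grid p s \<Longrightarrow> f \<in> line_code p s r \<Longrightarrow> code_perm p s t f \<in> code_perms p s r"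
  unfolding code_perms_def by blast

lemma code_perms_comp:
  assumes "p > 0" "h \<in> code_perms p s r" "k \<in> code_perms p s r"
  shows "h \<circ> k \<in> code_perms p s r"
proof -
  obtain t f where h: "h = code_perm p s t f" "f \<in> line_code p s r"
    using assms(2) unfolding code_perms_def by blast
  obtain u g where k: "k = code_perm p s u g" "g \<in> line_code p s r"
    using assms(3) unfolding code_perms_def by blast
  show ?thesis
    unfolding h(1) k(1) code_perm_comp using assms(1) h(2) k(2)
    by (intro code_permsI add_mod_in_grid line_code_add line_code_shift)
qed

lemma code_perms_inverse:
  assumes p: "p > 0" and h: "h \<in> code_perms p s r"
  shows "\<exists>k\<in>code_perms p s r. \<forall>x\<in>grid p s \<times> {0..<p}. k (h x) = x"
proof -
  obtain t f where h: "h = code_perm p s t f" "f \<in> line_code p s r"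
    using h unfolding code_perms_def by blast
  \<comment> \<open>The negative of \<open>t\<close>, written through \<open>add_mod\<close> so that
    it is reduced and lies in the grid.\<close>
  define u where "u = add_mod p s (\<lambda>i. 0) (\<lambda>i. - t i)"
  have inv: "add_mod p s (add_mod p s v t) u = v" if "v \<in> grid p s" for v
  proof (rule grid_ext[OF add_mod_in_grid[OF p] that])
    fix i assume "i < s"
    then show "add_mod p s (add_mod p s v t) u i = v i"
      using grid_nth[OF that \<open>i < s\<close>] by (simp add: add_mod_def u_def mod_simps)
  qed
  \<comment> \<open>By the time the inverse acts, the vector is already translated; shifting by
    \<open>u\<close> makes \<open>f\<close> be evaluated at the original vector again.\<close>
  let ?k = "code_perm p s u (\<lambda>v. - f (add_mod p s v u))"
  have "?k \<in> code_perms p s r"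
    unfolding u_def using p h(2) by (intro code_permsI add_mod_in_grid line_code_uminus line_code_shift)
  moreover have "?k (h x) = x" if "x \<in> grid p s \<times> {0..<p}" for x
    using that inv by (auto simp: h code_perm_def mod_simps)
  ultimately show ?thesis by blast
qed

text \<open>A translation matches the vectors, and the constant word \<open>b - a\<close> corrects
  the residue.\<close>

lemma code_perms_transitive:
  assumes p: "p > 0" and "x \<in> grid p s \<times> {0..<p}" "y \<in> grid p s \<times> {0..<p}"
  shows "\<exists>h\<in>code_perms p s r. h x = y"
proof -
  obtain v a w b where xy: "x = (v, a)" "y = (w, b)" "v \<in> grid p s" "w \<in> grid p s" "b \<in> {0..<p}"
    using assms by auto
  define t where "t = add_mod p s w (\<lambda>i. - v i)"
  have "add_mod p s v t = w"
  proof (rule grid_ext[OF add_mod_in_grid[OF p] xy(4)])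
    fix i assume "i < s"
    then show "add_mod p s v t i = w i"
      using grid_nth[OF xy(4) \<open>i < s\<close>] by (simp add: add_mod_def t_def mod_simps)
  qed
  then have "code_perm p s t (\<lambda>v. b - a) x = y"
    using xy by (simp add: code_perm_def)
  moreover have "code_perm p s t (\<lambda>v. b - a) \<in> code_perms p s r"
    unfolding t_def using p by (intro code_permsI add_mod_in_grid line_code_const)
  ultimately show ?thesis by blast
qed

lemma code_perms_bij:
  assumes p: "p > 0" and h: "h \<in> code_perms p s r"
  shows "bij_betw h (grid p s \<times> {0..<p}) (grid p s \<times> {0..<p})" (is "bij_betw h ?X ?X")
proof -
  have "finite ?X" by (simp add: finite_grid)
  moreover have "h ` ?X \<subseteq> ?X"
    using h code_perm_maps[OF p] unfolding code_perms_def by blast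
  moreover have "inj_on h ?X"
    using code_perms_inverse[OF assms] by (metis inj_on_def)
  ultimately show ?thesis by (simp add: bij_betw_def endo_inj_surj)
qed

lemma code_perms_move_many:
  assumes p: "prime p" and h: "h \<in> code_perms p s r"
    and moved: "x \<in> grid p s \<times> {0..<p}" "h x \<noteq> x"
  shows "nat p * (nat p - r) ^ s \<le> card {x \<in> grid p s \<times> {0..<p}. h x \<noteq> x}"
    (is "_ \<le> card ?M")
proof -
  have p0: "p > 0" using p prime_gt_0_int by simp
  obtain t f where tf: "h = code_perm p s t f" "t \<in> grid p s" "f \<in> line_code p s r"
    using h unfolding code_perms_def by blast
  have finM: "finite ?M" by (simp add: finite_grid)
  show ?thesis
  proof (cases "\<exists>i<s. t i \<noteq> 0")
    case True
    then obtain i where i: "i < s" "t i \<noteq> 0" by blast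
    have "add_mod p s v t \<noteq> v" if v: "v \<in> grid p s" for v
    proof
      assume "add_mod p s v t = v"
      moreover have "add_mod p s v t i = (v i + t i) mod p" using i(1) by (simp add: add_mod_def)
      ultimately have "(v i + t i) mod p = v i" by simp
      \<comment> \<open>A fixed vector forces \<open>t i\<close> to be a multiple of
        \<open>p\<close>, impossible for a nonzero reduced coordinate.\<close>
      then have "p dvd t i" by (metis add_diff_cancel_left' dvd_minus_mod)
      then show False using grid_nth[OF tf(2) i(1)] i(2) by (simp add: zdvd_not_zless)
    qed
    then have "?M = grid p s \<times> {0..<p}" by (auto simp: tf(1) code_perm_def)
    then have "card ?M = nat p ^ s * nat p" by (simp add: card_cartesian_product card_grid)
    moreover have "(nat p - r) ^ s \<le> nat p ^ s" by (rule power_mono) simp_all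
    ultimately show ?thesis by (simp add: mult.commute)
  next
    case False
    have fixv: "add_mod p s v t = v" if "v \<in> grid p s" for v
      using False grid_nth[OF that]
      by (intro grid_ext[OF add_mod_in_grid[OF p0] that]) (simp add: add_mod_def)
    have fixy: "(y + f v) mod p = y \<longleftrightarrow> p dvd f v" if "y \<in> {0..<p}" for v y
      using that by (metis add_diff_cancel_left' atLeastLessThan_iff mod_eq_dvd_iff mod_pos_pos_trivial)
    \<comment> \<open>With trivial translation, a fibre is moved entirely or fixed pointwise
      according to whether its vector lies in the support of \<open>f\<close>.\<close>
    have M: "?M = {v \<in> grid p s. \<not> p dvd f v} \<times> {0..<p}"
      using fixv fixy by (auto simp: tf(1) code_perm_def)
    then have "x \<in> {v \<in> grid p s. \<not> p dvd f v} \<times> {0..<p}" using moved by blast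
    then have "(nat p - r) ^ s \<le> card {v \<in> grid p s. \<not> p dvd f v}"
      using line_code_weight[OF p tf(3)] by blast
    then show ?thesis unfolding M by (simp add: card_cartesian_product mult.commute)
  qed
qed

text \<open>The translation is the zero vector in its extensional grid form; the second component at
  the points \<open>(v, 0)\<close> recovers the word modulo \<open>p\<close>.\<close>

lemma lagrange_perms_inj:
  assumes p: "prime p" and r: "int r < p"
  shows "inj_on (\<lambda>c. restrict (code_perm p s (add_mod p s (\<lambda>i. 0) (\<lambda>i. 0)) (lagrange_word s r c)) (grid p s \<times> {0..<p}))
    (grid (int r + 1) s \<rightarrow>\<^sub>E {0..<p})"
proof (rule inj_onI)
  fix c d
  assume c: "c \<in> grid (int r + 1) s \<rightarrow>\<^sub>E {0..<p}" and d: "d \<in> grid (int r + 1) s \<rightarrow>\<^sub>E {0..<p}"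
    and eq: "restrict (code_perm p s (add_mod p s (\<lambda>i. 0) (\<lambda>i. 0)) (lagrange_word s r c)) (grid p s \<times> {0..<p})
      = restrict (code_perm p s (add_mod p s (\<lambda>i. 0) (\<lambda>i. 0)) (lagrange_word s r d)) (grid p s \<times> {0..<p})"
  have p0: "p > 0" using p prime_gt_0_int by simp
  show "c = d"
  proof (rule lagrange_word_inj[OF p r c d])
    fix v assume "v \<in> grid p s"
    then have "(v, 0) \<in> grid p s \<times> {0..<p}" using p0 by simp
    with fun_cong[OF eq, of "(v, 0)"]
    have "lagrange_word s r c v mod p = lagrange_word s r d v mod p"
      by (simp add: code_perm_def)
    then show "p dvd lagrange_word s r c v - lagrange_word s r d v"
      by (simp add: mod_eq_dvd_iff)
  qed
qed

section \<open>The group on natural numbers and its two bounds\<close>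

text \<open>The base size bound compares exponents of \<open>p\<close>: the order is at least
  \<open>p ^ (Suc r ^ s)\<close> by interpolation and at most
  \<open>(p ^ Suc s) ^ base_size \<Omega> G\<close>. No logarithms enter.\<close>

lemma ex_transitive_group:
  fixes p r s :: nat
  assumes p: "prime p" and r: "r < p"
  shows "\<exists>(\<Omega>::nat set) G. card \<Omega> = p ^ Suc s \<and> transitive_permutation_group \<Omega> G \<and>
    G \<noteq> {\<one>\<^bsub>BijGroup \<Omega>\<^esub>} \<and> p * (p - r) ^ s \<le> minimal_degree \<Omega> G \<and>
    Suc r ^ s \<le> Suc s * base_size \<Omega> G"
proof -
  define X where "X = grid (int p) s \<times> {0..<int p}"
  define S where "S = code_perms (int p) s r"
  have p0: "int p > 0" and pp: "prime (int p)" using p by (simp_all add: prime_gt_0_nat)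
  have finX: "finite X" by (simp add: X_def finite_grid)
  obtain e :: "(nat \<Rightarrow> int) \<times> int \<Rightarrow> nat" where e: "inj_on e X"
    using finite_imp_inj_to_nat_seg[OF finX] by blast
  define \<Omega> where "\<Omega> = e ` X"
  define G where "G = transport_perm e X ` S"
  have bij: "bij_betw h X X" if "h \<in> S" for h
    using code_perms_bij[OF p0] that unfolding X_def S_def by blast
  have trans: "transitive_permutation_group \<Omega> G"
    unfolding \<Omega>_def G_def
  proof (rule transitive_permutation_group_transport_perm[OF finX e _ bij])
    show "S \<noteq> {}"
      unfolding S_def using code_permsI[OF add_mod_in_grid[OF p0] line_code_const] by blast
  qed (use code_perms_comp[OF p0] code_perms_inverse[OF p0] code_perms_transitive[OF p0] in
      \<open>simp_all add: X_def S_def\<close>)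
  then have perm: "permutation_group \<Omega> G" by (simp add: transitive_permutation_group_def)
  have card\<Omega>: "card \<Omega> = p ^ Suc s"
    unfolding \<Omega>_def card_image[OF e] by (simp add: X_def card_cartesian_product card_grid)
  \<comment> \<open>Words are arbitrary off the grid, so finiteness is obtained from
    \<open>G\<close>, whose members are extensional self-maps of \<open>\<Omega>\<close>, and not
    from \<open>S\<close>.\<close>
  have finG: "finite G"
  proof (rule finite_subset)
    show "G \<subseteq> \<Omega> \<rightarrow>\<^sub>E \<Omega>"
    proof
      fix g assume "g \<in> G"
      then have "g \<in> Bij \<Omega>" using transport_perm_Bij[OF e bij] unfolding G_def \<Omega>_def by blast
      then show "g \<in> \<Omega> \<rightarrow>\<^sub>E \<Omega>"
        by (simp only: PiE_def Int_iff Bij_imp_funcset Bij_imp_extensional)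
    qed
    show "finite (\<Omega> \<rightarrow>\<^sub>E \<Omega>)" using finX by (simp add: \<Omega>_def finite_PiE)
  qed
  have cardG: "p ^ (Suc r ^ s) \<le> card G"
  proof -
    define I where "I = grid (int r + 1) s \<rightarrow>\<^sub>E {0..<int p}"
    define F where "F c = code_perm (int p) s (add_mod (int p) s (\<lambda>i. 0) (\<lambda>i. 0)) (lagrange_word s r c)" for c
    have F: "F c \<in> S" for c
      unfolding F_def S_def by (intro code_permsI add_mod_in_grid p0 lagrange_word_in_line_code)
    have "inj_on (\<lambda>c. restrict (F c) X) I"
      using lagrange_perms_inj[OF pp] r unfolding F_def X_def I_def by simp
    then have "inj_on (\<lambda>c. transport_perm e X (F c)) I"
      by (rule inj_on_transport_perm[OF e]) (use bij[OF F] bij_betw_imp_funcset in blast)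
    moreover have "(\<lambda>c. transport_perm e X (F c)) ` I \<subseteq> G" using F by (auto simp: G_def)
    ultimately have "card I \<le> card G" using finG by (rule card_inj_on_le)
    moreover have "card I = p ^ (Suc r ^ s)"
      unfolding I_def using card_grid[of "int r + 1" s]
      by (subst card_PiE[OF finite_grid]) (simp add: nat_add_distrib)
    ultimately show ?thesis by simp
  qed
  have p1: "p > 1" using p prime_gt_1_nat by blast
  have ne: "G \<noteq> {\<one>\<^bsub>BijGroup \<Omega>\<^esub>}"
  proof
    assume "G = {\<one>\<^bsub>BijGroup \<Omega>\<^esub>}"
    then have "p ^ (Suc r ^ s) \<le> 1" using cardG by simp
    moreover have "1 < p ^ (Suc r ^ s)" using p1 by (intro one_less_power) simp_all
    ultimately show False by simp
  qed
  have "p * (p - r) ^ s \<le> minimal_degree \<Omega> G"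
  proof (rule le_minimal_degree[OF perm ne])
    fix g assume g: "g \<in> G" "g \<noteq> \<one>\<^bsub>BijGroup \<Omega>\<^esub>"
    then obtain h where h: "h \<in> S" "g = transport_perm e X h" by (auto simp: G_def)
    then obtain x where "x \<in> X" "h x \<noteq> x"
      using g(2) transport_perm_eq_one_iff[OF e bij] unfolding \<Omega>_def by blast
    then have "p * (p - r) ^ s \<le> card {x \<in> X. h x \<noteq> x}"
      using code_perms_move_many[OF pp, of h s r x] h(1) unfolding X_def S_def by simp
    then show "p * (p - r) ^ s \<le> card (moved_points \<Omega> g)"
      using card_moved_points_transport_perm[OF e bij[OF h(1)]] by (simp add: \<Omega>_def h(2))
  qed
  moreover have "Suc r ^ s \<le> Suc s * base_size \<Omega> G"
  proof -
    have "p ^ (Suc r ^ s) \<le> p ^ (Suc s * base_size \<Omega> G)"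
      using cardG card_le_power_base_size[OF perm] unfolding card\<Omega> power_mult by linarith
    then show ?thesis using p1 power_le_imp_le_exp by blast
  qed
  ultimately show ?thesis using trans ne card\<Omega> by blast
qed

section \<open>Choice of the parameters\<close>

theorem theorem1p1:
  shows "\<forall>\<epsilon>::real. \<epsilon> > 0 \<longrightarrow>
    (\<exists>(n::nat) (\<Omega>::nat set) (G::(nat \<Rightarrow> nat) set).
       n > 0 \<and> card \<Omega> = n \<and>
       transitive_permutation_group \<Omega> G \<and> G \<noteq> {\<one>\<^bsub>BijGroup \<Omega>\<^esub>} \<and>
       real (minimal_degree \<Omega> G) * real (base_size \<Omega> G) \<ge> real n powr (2 - \<epsilon>))"
proof (intro allI impI)
  fix \<epsilon> :: real assume \<epsilon>: "\<epsilon> > 0"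
  \<comment> \<open>This size of \<open>s\<close> gives \<open>(s + 1) * \<epsilon> \<ge> 2\<close>,
    hence the exponent \<open>(s + 1) * (2 - \<epsilon>)\<close> of \<open>p\<close> is at most
    \<open>2 * s\<close>, one below the available \<open>2 * s + 1\<close>.\<close>
  obtain s :: nat where s: "2 / \<epsilon> < real s" using reals_Archimedean2 by blast
  \<comment> \<open>The spare factor \<open>p\<close> is to absorb the constant
    \<open>4 ^ s * Suc s\<close>; the extra \<open>2\<close> makes \<open>p\<close> odd.\<close>
  obtain p :: nat where p: "prime p" "p > 4 ^ s * Suc s + 2" using bigger_prime by blast
  then have "odd p" using prime_odd_nat by simp
  \<comment> \<open>The balanced choice: \<open>p - r\<close> and \<open>Suc r\<close> coincide and
    exceed \<open>p / 2\<close>, so both bounds lose only a factor of at most \<open>2 ^ s\<close>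
    against \<open>p ^ s\<close>.\<close>
  then obtain r where r: "p = 2 * r + 1" by (rule oddE)
  obtain \<Omega> :: "nat set" and G where G: "card \<Omega> = p ^ Suc s" "transitive_permutation_group \<Omega> G"
    "G \<noteq> {\<one>\<^bsub>BijGroup \<Omega>\<^esub>}" "p * (p - r) ^ s \<le> minimal_degree \<Omega> G"
    "Suc r ^ s \<le> Suc s * base_size \<Omega> G"
    using ex_transitive_group[OF p(1), of r s] r by auto
  let ?\<mu> = "real (minimal_degree \<Omega> G)" and ?b = "real (base_size \<Omega> G)"
  have p0: "real p > 1" using p by simp
  have half: "(real p / 2) ^ s \<le> real (Suc r) ^ s" using r by (intro power_mono) simp_all
  have \<mu>: "real p * (real p / 2) ^ s \<le> ?\<mu>"
  proof -
    have "real p * (real p / 2) ^ s \<le> real p * real (Suc r) ^ s" using half by (intro mult_left_mono) simp_all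
    also have "\<dots> = real (p * (p - r) ^ s)" using r by (simp add: algebra_simps)
    also have "\<dots> \<le> ?\<mu>" using G(4) by (rule of_nat_mono)
    finally show ?thesis .
  qed
  have b: "(real p / 2) ^ s \<le> real (Suc s) * ?b"
  proof -
    have "real (Suc r) ^ s \<le> real (Suc s) * ?b"
      using of_nat_mono[OF G(5), where 'a = real] by (simp only: of_nat_power of_nat_mult)
    then show ?thesis using half by linarith
  qed
  have exponent: "real (Suc s) * (2 - \<epsilon>) \<le> real (2 * s)"
    using s \<epsilon> by (simp add: field_simps)
  have "real (p ^ Suc s) powr (2 - \<epsilon>) = real p powr (real (Suc s) * (2 - \<epsilon>))"
    using p0 by (simp add: powr_powr[symmetric] powr_realpow[symmetric] del: of_nat_Suc power_Suc)
  also have "\<dots> \<le> real p powr real (2 * s)"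
    using p0 exponent by (intro powr_mono) simp_all
  also have "\<dots> = real p ^ (2 * s)"
    using p0 by (intro powr_realpow) simp
  also have "\<dots> \<le> ?\<mu> * ?b"
  proof -
    \<comment> \<open>Both sides are scaled by \<open>4 ^ s * Suc s\<close>, which is below
      \<open>p\<close>; this positive constant is cancelled at the end.\<close>
    have "real (4 ^ s * Suc s) * real p ^ (2 * s) \<le> real p * real p ^ (2 * s)"
      using p by (intro mult_right_mono) (simp_all only: of_nat_le_iff zero_le_power of_nat_0_le_iff)
    also have "\<dots> = 4 ^ s * ((real p * (real p / 2) ^ s) * (real p / 2) ^ s)"
      by (simp add: power_mult power2_eq_square power_mult_distrib power_divide flip: power_mult_distrib)
    also have "\<dots> \<le> 4 ^ s * (?\<mu> * (real (Suc s) * ?b))"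
      using \<mu> b by (intro mult_left_mono mult_mono) simp_all
    also have "\<dots> = real (4 ^ s * Suc s) * (?\<mu> * ?b)" by (simp add: algebra_simps)
    finally show ?thesis by (rule mult_left_le_imp_le) (simp only: of_nat_0_less_iff zero_less_Suc nat_0_less_mult_iff zero_less_power zero_less_numeral simp_thms)
  qed
  finally have "real (p ^ Suc s) powr (2 - \<epsilon>) \<le> ?\<mu> * ?b" .
  moreover have "p ^ Suc s > 0" using p(1) prime_gt_0_nat by simp
  ultimately show "\<exists>n (\<Omega>::nat set) G. n > 0 \<and> card \<Omega> = n \<and>
       transitive_permutation_group \<Omega> G \<and> G \<noteq> {\<one>\<^bsub>BijGroup \<Omega>\<^esub>} \<and>
       real (minimal_degree \<Omega> G) * real (base_size \<Omega> G) \<ge> real n powr (2 - \<epsilon>)"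
    using G(1-3) by blast
qed

end
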